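(* Let $\alpha,\gamma\in l_1(\mathbb{Z})$ be masks, let $\mathcal{S}_\alpha$ be the subdivision operator with mask $\alpha$ and let $\mathcal{D}_\gamma$ be the decimation operator with mask $\gamma$. Then the following are equivalent: (a) for every $c\in l_\infty(\mathbb{Z})$ the sequence $d:=(\mathcal{I}-\mathcal{S}_\alpha\mathcal{D}_\gamma)c$ satisfies $d\downarrow 2=0$, i.e. $d_{2k}=0$ for all $k\in\mathbb{Z}$; (b) $\gamma$ is the inverse of $\alpha_{ev}$, i.e. $\alpha_{ev}(z)\gamma(z)=1$ for all $z\in\mathbb{T}$.
   Context: All sequences are real-valued and indexed by $\mathbb{Z}$; $l_1(\mathbb{Z})$ and $l_\infty(\mathbb{Z})$ are the usual sequence spaces, and a mask is an element of $l_1(\mathbb{Z})$. Downsampling: $(c\downarrow 2)_k:=c_{2k}$. Convolution: $(\alpha*c)_k:=\sum_{\ell\in\mathbb{Z}}\alpha_\ell c_{k-\ell}$ for $\alpha\in l_1(\mathbb{Z})$, $c\in l_\infty(\mathbb{Z})$. The subdivision operator $\mathcal{S}_\alpha:l_\infty(\mathbb{Z})\to l_\infty(\mathbb{Z})$ is $(\mathcal{S}_\alpha c)_k:=\sum_{\ell\in\mathbb{Z}}\alpha_{k-2\ell}c_\ell$. The decimation operator is $\mathcal{D}_\gamma c:=\gamma*(c\downarrow 2)$. $\mathcal{I}$ is the identity operator. The symbol of a sequence $c$ is $c(z):=\sum_{k\in\mathbb{Z}}c_kz^k$; the even part $\alpha_{ev}$ of $\alpha$ is $(\alpha_{ev})_k:=\alpha_{2k}$,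 with symbol $\alpha_{ev}(z)$. $\mathbb{T}:=\{z\in\mathbb{C}:|z|=1\}$. *)

theory Defs
  imports "HOL-Analysis.Analysis"
begin

definition l1_seq :: "(int \<Rightarrow> real) set" where
  "l1_seq = {c. (\<lambda>k. \<bar>c k\<bar>) summable_on UNIV}"

definition linf_seq :: "(int \<Rightarrow> real) set" where
  "linf_seq = {c. bounded (range c)}"

definition downsample :: "(int \<Rightarrow> 'a) \<Rightarrow> int \<Rightarrow> 'a" where
  "downsample c = (\<lambda>k. c (2 * k))"

definition even_part :: "(int \<Rightarrow> 'a) \<Rightarrow> int \<Rightarrow> 'a" where
  "even_part \<alpha> = (\<lambda>k. \<alpha> (2 * k))"

text \<open>
  All sums over the integers below are unordered (\<^const>\<open>infsum\<close>, which is \<open>0\<close> on non-summable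
  families). For masks in \<^const>\<open>l1_seq\<close>, arguments in \<^const>\<open>linf_seq\<close> and \<open>z\<close> on the unit circle
  they converge absolutely.
\<close>

definition convolution :: "(int \<Rightarrow> real) \<Rightarrow> (int \<Rightarrow> real) \<Rightarrow> int \<Rightarrow> real" where
  "convolution \<alpha> c = (\<lambda>k. \<Sum>\<^sub>\<infinity>l\<in>UNIV. \<alpha> l * c (k - l))"

definition subdivision :: "(int \<Rightarrow> real) \<Rightarrow> (int \<Rightarrow> real) \<Rightarrow> int \<Rightarrow> real" where
  "subdivision \<alpha> c = (\<lambda>k. \<Sum>\<^sub>\<infinity>l\<in>UNIV. \<alpha> (k - 2 * l) * c l)"

definition decimation :: "(int \<Rightarrow> real) \<Rightarrow> (int \<Rightarrow> real) \<Rightarrow> int \<Rightarrow> real" where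
  "decimation \<gamma> c = convolution \<gamma> (downsample c)"

definition seq_symbol :: "(int \<Rightarrow> real) \<Rightarrow> complex \<Rightarrow> complex" where
  "seq_symbol c z = (\<Sum>\<^sub>\<infinity>k\<in>UNIV. complex_of_real (c k) * z powi k)"

end

theory Submission
  imports Defs "HOL-Library.Real_Mod"
begin

text \<open>
  Even samples of a subdivided sequence only involve even-indexed mask entries: downsampling
  after \<open>S\<^sub>\<alpha>\<close> is plain convolution with \<open>\<alpha>\<^sub>e\<^sub>v\<close>
  (\<open>downsample_subdivision\<close>). Hence \<open>((I - S\<^sub>\<alpha> D\<^sub>\<gamma>) c) \<down> 2\<close> equals
  \<open>e - \<alpha>\<^sub>e\<^sub>v * (\<gamma> * e)\<close> with \<open>e = c \<down> 2\<close>, and by associativity this is \<open>e - h * e\<close>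
  for \<open>h = \<alpha>\<^sub>e\<^sub>v * \<gamma>\<close>. Every bounded \<open>e\<close> arises as the even samples of a bounded \<open>c\<close>, so this
  difference vanishes for all bounded \<open>c\<close> if and only if convolution with \<open>h\<close> is the identity
  on bounded sequences; testing on the unit impulse shows that this means that \<open>h\<close> is the unit
  impulse. The symbol of \<open>h\<close> is the product
  of the symbols of \<open>\<alpha>\<^sub>e\<^sub>v\<close> and \<open>\<gamma>\<close>, and the impulse has symbol \<open>1\<close>, so it remains to
  know that a summable sequence is determined by its symbol on the unit circle.

  Two facts carry the argument. Associativity of convolution and multiplicativity of symbols are
  both instances of one Fubini identity, obtained by summing \<open>a l * g m * w (l + m)\<close> over the
  plane for a bounded weight \<open>w\<close> (\<open>infsum_convolution_weighted\<close>). Injectivity of the symbol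
  (\<open>seq_symbol_eq_0_imp_eq_0\<close>) is proved with finite averages in place of Fourier integrals:
  averaging \<open>h(z) z\<^bsup>-n\<^esup>\<close> over the \<open>N\<close>-th roots of unity yields the sum of \<open>h\<close> over the residue
  class of \<open>n\<close> modulo \<open>N\<close>, and for large \<open>N\<close> the members of that class other than \<open>n\<close> lie in
  the tail of \<open>h\<close>.
\<close>

section \<open>Absolutely summable double series\<close>

lemma l1_seqD:
  assumes "a \<in> l1_seq"
  shows "(\<lambda>k. \<bar>a k\<bar>) summable_on A"
  using assms summable_on_subset_banach[of _ UNIV] unfolding l1_seq_def by blast

lemma l1_seq_summable:
  assumes "a \<in> l1_seq"
  shows "a summable_on A"
  by (rule abs_summable_summable) (simp add: l1_seqD[OF assms])

lemma has_sum_single_support: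
  fixes x :: "int \<Rightarrow> 'b::{comm_monoid_add,t2_space}"
  assumes "\<And>k. k \<noteq> i \<Longrightarrow> x k = 0"
  shows "(x has_sum x i) UNIV"
  by (rule has_sum_finite_neutralI[where B = "{i}"]) (use assms in auto)

lemma summable_on_weighted_product:
  fixes w :: "int \<Rightarrow> 'b::banach"
  assumes a: "a \<in> l1_seq" and g: "g \<in> l1_seq" and w: "bounded (range w)"
  shows "(\<lambda>(l, m). norm ((a l * g m) *\<^sub>R w (l + m))) summable_on UNIV \<times> UNIV"
proof -
  obtain B where B: "\<And>k. norm (w k) \<le> B"
    using w by (auto simp: bounded_iff)
  have "(\<lambda>p. \<bar>a (fst p)\<bar> * (\<bar>g (snd p)\<bar> * B)) summable_on (UNIV \<times> UNIV)"
  proof (rule summable_on_SigmaI)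
    show "((\<lambda>m. \<bar>a (fst (l, m))\<bar> * (\<bar>g (snd (l, m))\<bar> * B)) has_sum
            \<bar>a l\<bar> * ((\<Sum>\<^sub>\<infinity>m\<in>UNIV. \<bar>g m\<bar>) * B)) UNIV" for l
      unfolding fst_conv snd_conv
      by (intro has_sum_cmult_right has_sum_cmult_left has_sum_infsum l1_seqD g)
    show "(\<lambda>l. \<bar>a l\<bar> * ((\<Sum>\<^sub>\<infinity>m\<in>UNIV. \<bar>g m\<bar>) * B)) summable_on UNIV"
      by (intro summable_on_cmult_left l1_seqD a)
    show "\<bar>a (fst (l, m))\<bar> * (\<bar>g (snd (l, m))\<bar> * B) \<ge> 0" for l m
      using order_trans[OF norm_ge_zero B] by simp
  qed
  then have "(\<lambda>p. norm ((a (fst p) * g (snd p)) *\<^sub>R w (fst p + snd p))) summable_on UNIV \<times> UNIV"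
    by (rule Infinite_Sum.abs_summable_on_comparison_test')
       (auto simp: abs_mult mult.assoc intro!: mult_left_mono B)
  then show ?thesis
    by (simp add: case_prod_unfold)
qed

text \<open>
  The change of variables \<open>n = l + m\<close>, which turns a double series over the two factors into
  one grouped by the index of the convolution.
\<close>

lemma summable_on_shear:
  fixes f :: "int \<times> int \<Rightarrow> 'b::banach"
  shows "(\<lambda>(n, l). f (l, n - l)) summable_on UNIV \<times> UNIV \<longleftrightarrow> f summable_on UNIV \<times> UNIV"
  by (rule summable_on_reindex_bij_witness[where j = "\<lambda>(n, l). (l, n - l)" and i = "\<lambda>(l, m). (l + m, l)"])
     auto

lemma summable_on_convolution_terms:
  assumes a: "a \<in> l1_seq" and g: "g \<in> l1_seq"
  shows "(\<lambda>(n, l). \<bar>a l * g (n - l)\<bar>) summable_on UNIV \<times> UNIV"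
proof -
  have "(\<lambda>p. \<bar>a (fst p) * g (snd p)\<bar>) summable_on UNIV \<times> UNIV"
    using summable_on_weighted_product[OF a g, of "\<lambda>_. 1::real"] by (simp add: case_prod_unfold)
  then show ?thesis
    using summable_on_shear[of "\<lambda>p. \<bar>a (fst p) * g (snd p)\<bar>"] by simp
qed

lemma summable_on_convolution_row:
  assumes a: "a \<in> l1_seq" and g: "g \<in> l1_seq"
  shows "(\<lambda>l. \<bar>a l * g (n - l)\<bar>) summable_on UNIV"
  using summable_on_SigmaD1[of "\<lambda>n l. \<bar>a l * g (n - l)\<bar>" UNIV "\<lambda>_. UNIV" n]
    summable_on_convolution_terms[OF a g] by simp

section \<open>Convolution of summable sequences\<close>

lemma convolution_in_l1_seq:
  assumes a: "a \<in> l1_seq" and g: "g \<in> l1_seq"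
  shows "convolution a g \<in> l1_seq"
proof -
  have rows: "(\<lambda>n. \<Sum>\<^sub>\<infinity>l\<in>UNIV. \<bar>a l * g (n - l)\<bar>) summable_on UNIV"
    using summable_on_Sigma_banach[of "\<lambda>n l. \<bar>a l * g (n - l)\<bar>" UNIV "\<lambda>_. UNIV"]
      summable_on_convolution_terms[OF a g] by simp
  have "norm (convolution a g n) \<le> (\<Sum>\<^sub>\<infinity>l\<in>UNIV. \<bar>a l * g (n - l)\<bar>)" for n
    unfolding convolution_def
    using norm_infsum_bound[of "\<lambda>l. a l * g (n - l)" UNIV] summable_on_convolution_row[OF a g, of n]
    by simp
  then have "(\<lambda>n. norm (convolution a g n)) summable_on UNIV"
    by (intro Infinite_Sum.abs_summable_on_comparison_test'[OF rows])
  then show ?thesis by (simp add: l1_seq_def)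
qed

text \<open>
  Pairing a convolution with a bounded weight is a double series over \<open>(l, m)\<close>. The weight
  \<open>w n = c (k - n)\<close> gives associativity, the weight \<open>w n = z\<^bsup>n\<^esup>\<close> gives multiplicativity of
  symbols; values in a Banach space serve both the real and the complex case.
\<close>

lemma infsum_convolution_weighted:
  fixes w :: "int \<Rightarrow> 'b::banach"
  assumes a: "a \<in> l1_seq" and g: "g \<in> l1_seq" and w: "bounded (range w)"
  shows "(\<Sum>\<^sub>\<infinity>n\<in>UNIV. convolution a g n *\<^sub>R w n) =
         (\<Sum>\<^sub>\<infinity>l\<in>UNIV. a l *\<^sub>R (\<Sum>\<^sub>\<infinity>m\<in>UNIV. g m *\<^sub>R w (l + m)))"
proof -
  define F where "F = (\<lambda>(l, m). (a l * g m) *\<^sub>R w (l + m))"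
  define G where "G = (\<lambda>(n, l). F (l, n - l))"
  have F: "F summable_on UNIV \<times> UNIV"
    by (rule abs_summable_summable)
       (use summable_on_weighted_product[OF a g w] in \<open>simp add: F_def case_prod_unfold\<close>)
  then have G: "G summable_on UNIV \<times> UNIV"
    using summable_on_shear[of F] by (simp add: G_def)
  have row: "(\<lambda>l. a l * g (n - l)) summable_on UNIV" for n
    by (rule abs_summable_summable) (simp add: summable_on_convolution_row[OF a g])
  have "(\<Sum>\<^sub>\<infinity>n\<in>UNIV. convolution a g n *\<^sub>R w n) = (\<Sum>\<^sub>\<infinity>n\<in>UNIV. \<Sum>\<^sub>\<infinity>l\<in>UNIV. G (n, l))"
    unfolding convolution_def G_def F_def
    by (intro infsum_cong) (simp add: infsum_scaleR_left row)
  also have "\<dots> = infsum G (UNIV \<times> UNIV)"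
    by (rule infsum_Sigma_banach[OF G])
  also have "\<dots> = infsum F (UNIV \<times> UNIV)"
    unfolding G_def
    by (rule infsum_reindex_bij_witness[where j = "\<lambda>(n, l). (l, n - l)" and i = "\<lambda>(l, m). (l + m, l)"])
       auto
  also have "\<dots> = (\<Sum>\<^sub>\<infinity>l\<in>UNIV. \<Sum>\<^sub>\<infinity>m\<in>UNIV. F (l, m))"
    by (rule infsum_Sigma_banach[OF F, symmetric])
  also have "\<dots> = (\<Sum>\<^sub>\<infinity>l\<in>UNIV. a l *\<^sub>R (\<Sum>\<^sub>\<infinity>m\<in>UNIV. g m *\<^sub>R w (l + m)))"
    unfolding F_def by (simp add: infsum_scaleR_right flip: scaleR_scaleR)
  finally show ?thesis .
qed

lemma convolution_commute: "convolution a c = convolution c a"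
proof
  fix k
  show "convolution a c k = convolution c a k"
    unfolding convolution_def
    by (rule infsum_reindex_bij_witness[where i = "\<lambda>l. k - l" and j = "\<lambda>l. k - l"]) auto
qed

lemma convolution_assoc:
  assumes a: "a \<in> l1_seq" and g: "g \<in> l1_seq" and c: "c \<in> linf_seq"
  shows "convolution a (convolution g c) = convolution (convolution a g) c"
proof
  fix k
  have "bounded (range (\<lambda>n. c (k - n)))"
    by (rule bounded_subset[of "range c"]) (use c in \<open>auto simp: linf_seq_def\<close>)
  from infsum_convolution_weighted[OF a g this]
  show "convolution a (convolution g c) k = convolution (convolution a g) c k"
    by (simp add: convolution_def diff_diff_eq)
qed

lemma bounded_range_powi:
  fixes z :: complex
  assumes "norm z = 1"
  shows "bounded (range (\<lambda>n. z powi n))"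
  using assms by (auto simp: bounded_iff norm_power_int intro: exI[of _ 1])

lemma seq_symbol_convolution:
  assumes a: "a \<in> l1_seq" and g: "g \<in> l1_seq" and z: "norm z = 1"
  shows "seq_symbol (convolution a g) z = seq_symbol a z * seq_symbol g z"
proof -
  have "z \<noteq> 0" using z by auto
  have "seq_symbol (convolution a g) z =
        (\<Sum>\<^sub>\<infinity>l\<in>UNIV. a l *\<^sub>R (\<Sum>\<^sub>\<infinity>m\<in>UNIV. g m *\<^sub>R z powi (l + m)))"
    using infsum_convolution_weighted[OF a g bounded_range_powi[OF z]]
    by (simp add: seq_symbol_def scaleR_conv_of_real)
  also have "\<dots> = (\<Sum>\<^sub>\<infinity>l\<in>UNIV. a l * z powi l * seq_symbol g z)"
    unfolding seq_symbol_def
    by (simp add: scaleR_conv_of_real power_int_add \<open>z \<noteq> 0\<close> mult.left_commute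
        infsum_cmult_right' mult.assoc)
  also have "\<dots> = seq_symbol a z * seq_symbol g z"
    unfolding seq_symbol_def by (rule infsum_cmult_left')
  finally show ?thesis .
qed

lemma seq_symbol_summable:
  assumes a: "a \<in> l1_seq" and z: "norm z = 1"
  shows "(\<lambda>k. complex_of_real (a k) * z powi k) summable_on UNIV"
  by (rule abs_summable_summable) (simp add: norm_mult norm_power_int z l1_seqD[OF a])

section \<open>A summable sequence is determined by its symbol\<close>

lemma sum_unity_roots_powi:
  fixes N :: nat and m :: int
  assumes "N > 0"
  shows "(\<Sum>j<N. cis (2 * pi * j / N) powi m) = (if int N dvd m then of_nat N else 0)"
proof -
  define q where "q = cis (2 * pi * m / N)"
  have "cis (2 * pi * j / N) powi m = q ^ j" for j :: nat
    by (simp add: q_def cis_power_int Complex.DeMoivre field_simps)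
  then have sum_eq: "(\<Sum>j<N. cis (2 * pi * j / N) powi m) = (\<Sum>j<N. q ^ j)"
    by simp
  have qN: "q ^ N = 1"
  proof -
    have "real N * (2 * pi * m / N) = 2 * pi * of_int m"
      using assms by simp
    then show ?thesis
      unfolding q_def Complex.DeMoivre by (simp only: cis_multiple_2pi Ints_of_int)
  qed
  have q1: "q = 1 \<longleftrightarrow> int N dvd m"
  proof -
    have "q = 1 \<longleftrightarrow> (\<exists>n::int. 2 * pi * m / N = of_int n * (2 * pi))"
      by (simp add: q_def cis_eq_1_iff)
    also have "\<dots> \<longleftrightarrow> (\<exists>n::int. real_of_int m = real_of_int (int N * n))"
      using assms by (simp add: field_simps)
    also have "\<dots> \<longleftrightarrow> int N dvd m"
      by (simp only: of_int_eq_iff dvd_def)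
    finally show ?thesis .
  qed
  show ?thesis
  proof (cases "q = 1")
    case True
    with q1 show ?thesis unfolding sum_eq by simp
  next
    case False
    with q1 show ?thesis unfolding sum_eq by (simp add: geometric_sum qN)
  qed
qed

lemma has_sum_finite_sum:
  fixes f :: "'j \<Rightarrow> 'a \<Rightarrow> 'b::{topological_comm_monoid_add,comm_monoid_add}"
  assumes "finite J" "\<And>j. j \<in> J \<Longrightarrow> (f j has_sum s j) A"
  shows "((\<lambda>x. \<Sum>j\<in>J. f j x) has_sum (\<Sum>j\<in>J. s j)) A"
  using assms by (induction J rule: finite_induct) (auto intro!: has_sum_add)

text \<open>
  Averaging over the \<open>N\<close>-th roots of unity acts as a filter that keeps exactly the indices
  congruent to \<open>n\<close>; the average is finite, so it commutes with the series of the symbol.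
\<close>

lemma residue_class_sum_eq_0:
  assumes h: "h \<in> l1_seq" and zero: "\<And>z. norm z = 1 \<Longrightarrow> seq_symbol h z = 0" and N: "N > 0"
  shows "(\<Sum>\<^sub>\<infinity>k\<in>{k. int N dvd k - n}. h k) = 0"
proof -
  define \<omega> where "\<omega> = (\<lambda>j::nat. cis (2 * pi * j / N))"
  have [simp]: "norm (\<omega> j) = 1" "\<omega> j \<noteq> 0" for j by (simp_all add: \<omega>_def)
  have "((\<lambda>k. of_real (h k) * \<omega> j powi (k - n)) has_sum 0) UNIV" for j
  proof -
    have "((\<lambda>k. of_real (h k) * \<omega> j powi k) has_sum 0) UNIV"
      using has_sum_infsum[OF seq_symbol_summable[OF h, of "\<omega> j"]] zero[of "\<omega> j"]
      by (simp add: seq_symbol_def)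
    from has_sum_cmult_left[OF this, of "\<omega> j powi (- n)"] show ?thesis
      by (simp add: power_int_diff power_int_minus divide_inverse mult.assoc)
  qed
  then have "((\<lambda>k. \<Sum>j<N. of_real (h k) * \<omega> j powi (k - n)) has_sum (\<Sum>j<N. 0)) UNIV"
    by (intro has_sum_finite_sum) auto
  moreover have "(\<Sum>j<N. of_real (h k) * \<omega> j powi (k - n)) =
      complex_of_real (if int N dvd k - n then h k * N else 0)" for k
    using sum_unity_roots_powi[OF N, of "k - n"]
    by (simp add: \<omega>_def flip: sum_distrib_left)
  ultimately have "((\<lambda>k. complex_of_real (if int N dvd k - n then h k * N else 0)) has_sum of_real 0) UNIV"
    by simp
  then have "((\<lambda>k. if int N dvd k - n then h k * N else 0) has_sum 0) UNIV"
    by (simp only: has_sum_of_real_iff)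
  then have "((\<lambda>k. h k * N) has_sum 0) {k. int N dvd k - n}"
    by (subst has_sum_cong_neutral[where T = UNIV]) auto
  then have "(h has_sum 0) {k. int N dvd k - n}"
    using N by (simp add: has_sum_cmult_left_iff)
  then show ?thesis by (rule infsumI)
qed

text \<open>
  As the residue class of \<open>n\<close> sums to zero, \<open>h n\<close> is minus the sum over the rest of the class.
  For a modulus exceeding the distance from \<open>n\<close> to every point of a finite set carrying
  all but \<open>\<epsilon>\<close> of the mass of \<open>h\<close>, that rest avoids the set and contributes at most \<open>\<epsilon>\<close>.
\<close>

lemma seq_symbol_eq_0_imp_eq_0:
  assumes h: "h \<in> l1_seq" and zero: "\<And>z. norm z = 1 \<Longrightarrow> seq_symbol h z = 0"
  shows "h n = 0"
proof -
  have "\<bar>h n\<bar> \<le> \<epsilon>" if "\<epsilon> > 0" for \<epsilon>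
  proof -
    obtain F where F: "finite F" "dist (\<Sum>k\<in>F. \<bar>h k\<bar>) (\<Sum>\<^sub>\<infinity>k\<in>UNIV. \<bar>h k\<bar>) \<le> \<epsilon>"
      using infsum_finite_approximation[OF l1_seqD[OF h] \<open>\<epsilon> > 0\<close>, of UNIV] by auto
    (* any positive integer larger than every distance |k - n| with k in F would do *)
    define N where "N = Suc (\<Sum>k\<in>F. nat \<bar>k - n\<bar>)"
    have small: "\<bar>k - n\<bar> < int N" if "k \<in> F" for k
    proof -
      have "nat \<bar>k - n\<bar> \<le> (\<Sum>k\<in>F. nat \<bar>k - n\<bar>)"
        by (rule member_le_sum) (use that F in auto)
      then show ?thesis unfolding N_def by linarith
    qed
    define R where "R = {k. int N dvd k - n} - {n}"
    have "k \<notin> F" if "k \<in> R" for k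
    proof
      assume "k \<in> F"
      have "k - n = 0"
        by (rule ccontr) (use small[OF \<open>k \<in> F\<close>] \<open>k \<in> R\<close> dvd_imp_le_int[of "k - n" "int N"] in \<open>auto simp: R_def\<close>)
      with \<open>k \<in> R\<close> show False by (simp add: R_def)
    qed
    then have R_tail: "R \<subseteq> UNIV - F" by blast
    have "insert n R = {k. int N dvd k - n}" by (auto simp: R_def)
    then have "0 = infsum h (insert n R)"
      using residue_class_sum_eq_0[OF h zero, of N n] by (simp add: N_def)
    also have "\<dots> = h n + infsum h R"
      by (subst infsum_insert) (auto simp: R_def l1_seq_summable[OF h])
    finally have "\<bar>h n\<bar> = \<bar>infsum h R\<bar>" by linarith
    also have "\<dots> \<le> (\<Sum>\<^sub>\<infinity>k\<in>R. \<bar>h k\<bar>)"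
      using norm_infsum_bound[of h R] l1_seqD[OF h, of R] by simp
    also have "\<dots> \<le> (\<Sum>\<^sub>\<infinity>k\<in>UNIV - F. \<bar>h k\<bar>)"
      by (rule infsum_mono_neutral) (use R_tail in \<open>auto intro: l1_seqD[OF h]\<close>)
    also have "\<dots> = (\<Sum>\<^sub>\<infinity>k\<in>UNIV. \<bar>h k\<bar>) - (\<Sum>k\<in>F. \<bar>h k\<bar>)"
      using F(1) by (subst infsum_Diff) (auto intro: l1_seqD[OF h])
    also have "\<dots> \<le> \<epsilon>"
      using F(2) by (simp add: dist_real_def)
    finally show ?thesis .
  qed
  from field_le_epsilon[of "\<bar>h n\<bar>" 0] this show ?thesis by simp
qed

section \<open>The unit impulse\<close>

definition unit_impulse :: "int \<Rightarrow> real" where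
  "unit_impulse k = (if k = 0 then 1 else 0)"

lemma unit_impulse_in_l1_seq: "unit_impulse \<in> l1_seq"
  using has_sum_imp_summable[OF has_sum_single_support[of 0 "\<lambda>k. \<bar>unit_impulse k\<bar>"]]
  by (simp add: l1_seq_def unit_impulse_def)

lemma seq_symbol_unit_impulse: "seq_symbol unit_impulse z = 1"
  using infsumI[OF has_sum_single_support[of 0 "\<lambda>k. complex_of_real (unit_impulse k) * z powi k"]]
  by (simp add: seq_symbol_def unit_impulse_def)

lemma convolution_unit_impulse: "convolution unit_impulse c = c"
proof
  show "convolution unit_impulse c k = c k" for k
    using infsumI[OF has_sum_single_support[of 0 "\<lambda>l. unit_impulse l * c (k - l)"]]
    by (simp add: convolution_def unit_impulse_def)
qed

lemma seq_symbol_eq_1_imp_unit_impulse: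
  assumes h: "h \<in> l1_seq" and one: "\<And>z. norm z = 1 \<Longrightarrow> seq_symbol h z = 1"
  shows "h = unit_impulse"
proof -
  define d where "d = (\<lambda>k. h k - unit_impulse k)"
  have "(\<lambda>k. \<bar>h k\<bar> + \<bar>unit_impulse k\<bar>) summable_on UNIV"
    by (intro summable_on_add l1_seqD h unit_impulse_in_l1_seq)
  then have d: "d \<in> l1_seq"
    using Infinite_Sum.abs_summable_on_comparison_test'[of "\<lambda>k. \<bar>h k\<bar> + \<bar>unit_impulse k\<bar>" UNIV d]
    by (simp add: l1_seq_def d_def abs_triangle_ineq4)
  have "seq_symbol d z = 0" if z: "norm z = 1" for z
  proof -
    have "((\<lambda>k. complex_of_real (d k) * z powi k) has_sum
           seq_symbol h z - seq_symbol unit_impulse z) UNIV"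
      unfolding d_def of_real_diff left_diff_distrib seq_symbol_def
      unfolding diff_conv_add_uminus
      by (intro has_sum_add has_sum_uminusI has_sum_infsum seq_symbol_summable
          h unit_impulse_in_l1_seq z)
    then have "seq_symbol d z = seq_symbol h z - seq_symbol unit_impulse z"
      unfolding seq_symbol_def by (rule infsumI)
    then show ?thesis by (simp add: one z seq_symbol_unit_impulse)
  qed
  then have "d k = 0" for k by (rule seq_symbol_eq_0_imp_eq_0[OF d])
  then show ?thesis by (auto simp: d_def)
qed

section \<open>Downsampling\<close>

lemma even_part_in_l1_seq:
  assumes "a \<in> l1_seq"
  shows "even_part a \<in> l1_seq"
proof -
  have "(\<lambda>k. \<bar>a k\<bar>) summable_on range (\<lambda>k. 2 * k)"
    by (rule l1_seqD[OF assms])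
  then show ?thesis
    by (subst (asm) summable_on_reindex) (auto simp: inj_on_def l1_seq_def even_part_def o_def)
qed

text \<open>
  At an even position \<open>2k\<close> the mask is read at \<open>2k - 2l = 2(k - l)\<close>, so only its even part enters.
\<close>

lemma downsample_subdivision:
  "downsample (subdivision a c) = convolution (even_part a) c"
proof
  fix k
  have "downsample (subdivision a c) k = convolution c (even_part a) k"
    by (simp add: downsample_def subdivision_def convolution_def even_part_def
        right_diff_distrib mult.commute)
  then show "downsample (subdivision a c) k = convolution (even_part a) c k"
    by (simp add: convolution_commute)
qed

text \<open>
  Lets the test sequences \<open>c \<down> 2\<close> be replaced by arbitrary bounded sequences, in particular by
  the unit impulse.
\<close>

lemma downsample_image_linf_seq: "downsample ` linf_seq = linf_seq"
proof
  show "downsample ` linf_seq \<subseteq> linf_seq"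
  proof safe
    fix c :: "int \<Rightarrow> real" assume "c \<in> linf_seq"
    then show "downsample c \<in> linf_seq"
      unfolding linf_seq_def downsample_def by (auto elim!: bounded_subset)
  qed
  show "linf_seq \<subseteq> downsample ` linf_seq"
  proof
    fix c :: "int \<Rightarrow> real" assume c: "c \<in> linf_seq"
    (* each value is written twice, so the even positions return c *)
    have "(\<lambda>k. c (k div 2)) \<in> linf_seq"
      using c unfolding linf_seq_def by (auto elim!: bounded_subset)
    moreover have "c = downsample (\<lambda>k. c (k div 2))"
      by (simp add: downsample_def)
    ultimately show "c \<in> downsample ` linf_seq" by blast
  qed
qed

section \<open>Even samples reproduced by subdivision after decimation\<close>

theorem theorem4:
  fixes \<alpha> \<gamma> :: "int \<Rightarrow> real"
  assumes "\<alpha> \<in> l1_seq" and "\<gamma> \<in> l1_seq"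
  shows "(\<forall>c\<in>linf_seq. downsample ((id - (subdivision \<alpha> \<circ> decimation \<gamma>)) c) = (\<lambda>k. 0))
    \<longleftrightarrow> (\<forall>z::complex. norm z = 1 \<longrightarrow> seq_symbol (even_part \<alpha>) z * seq_symbol \<gamma> z = 1)"
proof -
  define h where "h = convolution (even_part \<alpha>) \<gamma>"
  note ev = even_part_in_l1_seq[OF assms(1)]
  have h: "h \<in> l1_seq"
    unfolding h_def by (rule convolution_in_l1_seq[OF ev assms(2)])
  have "downsample ((id - (subdivision \<alpha> \<circ> decimation \<gamma>)) c) = (\<lambda>k. 0) \<longleftrightarrow>
        convolution h (downsample c) = downsample c" if "c \<in> linf_seq" for c
  proof -
    have "downsample c \<in> linf_seq"
      using that downsample_image_linf_seq by blast
    then have "downsample (subdivision \<alpha> (decimation \<gamma> c)) = convolution h (downsample c)"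
      by (simp add: downsample_subdivision decimation_def h_def convolution_assoc ev assms(2))
    moreover have "downsample ((id - (subdivision \<alpha> \<circ> decimation \<gamma>)) c) =
        (\<lambda>k. downsample c k - downsample (subdivision \<alpha> (decimation \<gamma> c)) k)"
      by (simp add: downsample_def)
    ultimately show ?thesis by (auto simp: fun_eq_iff)
  qed
  then have "(\<forall>c\<in>linf_seq. downsample ((id - (subdivision \<alpha> \<circ> decimation \<gamma>)) c) = (\<lambda>k. 0)) \<longleftrightarrow>
      (\<forall>c\<in>downsample ` linf_seq. convolution h c = c)"
    by simp
  also have "\<dots> \<longleftrightarrow> (\<forall>c\<in>linf_seq. convolution h c = c)"
    unfolding downsample_image_linf_seq ..
  also have "\<dots> \<longleftrightarrow> h = unit_impulse"
  proof
    assume *: "\<forall>c\<in>linf_seq. convolution h c = c"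
    have "unit_impulse \<in> linf_seq"
      by (auto simp: linf_seq_def bounded_iff unit_impulse_def intro!: exI[of _ 1])
    with * have "convolution h unit_impulse = unit_impulse" by blast
    then show "h = unit_impulse"
      by (simp add: convolution_commute[of h] convolution_unit_impulse)
  qed (simp add: convolution_unit_impulse)
  also have "\<dots> \<longleftrightarrow> (\<forall>z. norm z = 1 \<longrightarrow> seq_symbol h z = 1)"
    using seq_symbol_eq_1_imp_unit_impulse[OF h] seq_symbol_unit_impulse by blast
  also have "\<dots> \<longleftrightarrow> (\<forall>z::complex. norm z = 1 \<longrightarrow> seq_symbol (even_part \<alpha>) z * seq_symbol \<gamma> z = 1)"
    by (simp add: h_def seq_symbol_convolution ev assms(2))
  finally show ?thesis .
qed

end
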